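(* Let $G$ be a finite simple graph with $n$ vertices and $m\ge1$ edges. Then \[NK(G^{-+-}) \le \left[m+n-1-\frac{4m}{n}\right]^{n}\left[(n-4)+\frac{1}{m}M_1(G)\right]^{m},\] with equality if and only if $G$ is a regular graph.
   Context: For a graph $H$, $NK(H)=\prod_{v\in V(H)} d_H(v)$ (Narumi-Katayama index). $M_1(G)=\sum_{v\in V(G)}d_G(v)^2=\sum_{uv\in E(G)}[d_G(u)+d_G(v)]$ is the first Zagreb index. For $x,y,z\in\{+,-\}$ the total transformation graph $G^{xyz}$ has vertex set $V(G)\cup E(G)$ (disjoint union) and two distinct vertices are adjacent as follows: two vertices of $G$ are adjacent iff they are adjacent in $G$ (if $x=+$), resp. non-adjacent in $G$ (if $x=-$); two edges of $G$ are adjacent iff they share an endpoint in $G$ (if $y=+$), resp. share no endpoint (if $y=-$); a vertex $u$ and an edge $e$ of $G$ are adjacent iff $u$ is incident to $e$ (if $z=+$), resp. not incident (if $z=-$). *)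

theory Defs
  imports Complex_Main
begin

record 'a ugraph =
  verts :: "'a set"
  edges :: "'a set set"

definition fin_simple_graph :: "'a ugraph \<Rightarrow> bool" where
  "fin_simple_graph G \<longleftrightarrow>
     finite (verts G) \<and> (\<forall>e \<in> edges G. e \<subseteq> verts G \<and> card e = 2)"

definition degree :: "'a ugraph \<Rightarrow> 'a \<Rightarrow> nat" where
  "degree G v = card {e \<in> edges G. v \<in> e}"

definition regular :: "'a ugraph \<Rightarrow> bool" where
  "regular G \<longleftrightarrow> (\<exists>k. \<forall>v \<in> verts G. degree G v = k)"

definition narumi_katayama :: "'a ugraph \<Rightarrow> nat" where
  "narumi_katayama G = (\<Prod>v \<in> verts G. degree G v)"

definition first_zagreb :: "'a ugraph \<Rightarrow> nat" where
  "first_zagreb G = (\<Sum>v \<in> verts G. (degree G v)\<^sup>2)"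

datatype sign = Plus | Minus

fun signed :: "sign \<Rightarrow> bool \<Rightarrow> bool" where
  "signed Plus P = P"
| "signed Minus P = (\<not> P)"

fun trans_adj :: "sign \<Rightarrow> sign \<Rightarrow> sign \<Rightarrow> 'a ugraph \<Rightarrow> 'a + 'a set \<Rightarrow> 'a + 'a set \<Rightarrow> bool" where
  "trans_adj x y z G (Inl u) (Inl v) = signed x ({u, v} \<in> edges G)"
| "trans_adj x y z G (Inr e) (Inr f) = signed y (e \<inter> f \<noteq> {})"
| "trans_adj x y z G (Inl u) (Inr e) = signed z (u \<in> e)"
| "trans_adj x y z G (Inr e) (Inl u) = signed z (u \<in> e)"

text \<open>The relation above is only meaningful for distinct arguments; distinctness is imposed here.\<close>

definition total_trans :: "sign \<Rightarrow> sign \<Rightarrow> sign \<Rightarrow> 'a ugraph \<Rightarrow> ('a + 'a set) ugraph" where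
  "total_trans x y z G =
     \<lparr> verts = verts G <+> edges G,
       edges = {{p, q} | p q. p \<in> verts G <+> edges G \<and> q \<in> verts G <+> edges G \<and>
                              p \<noteq> q \<and> trans_adj x y z G p q} \<rparr>"

lemma trans_adj_sym: "trans_adj x y z G p q \<longleftrightarrow> trans_adj x y z G q p"
  by (cases p; cases q) (simp_all add: insert_commute Int_commute)

lemma total_trans_edge_iff:
  assumes "p \<in> verts G <+> edges G" "q \<in> verts G <+> edges G" "p \<noteq> q"
  shows "{p, q} \<in> edges (total_trans x y z G) \<longleftrightarrow> trans_adj x y z G p q"
  using assms trans_adj_sym[of x y z G p q]
  by (auto simp: total_trans_def doubleton_eq_iff simp del: Plus_def)

lemma fin_simple_graph_total_trans:
  assumes "fin_simple_graph G"
  shows "fin_simple_graph (total_trans x y z G)"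
proof -
  have "edges G \<subseteq> Pow (verts G)" "finite (verts G)"
    using assms by (auto simp: fin_simple_graph_def)
  then have "finite (edges G)"
    by (meson finite_Pow_iff finite_subset)
  with \<open>finite (verts G)\<close> show ?thesis
    by (fastforce simp: fin_simple_graph_def total_trans_def card_2_iff simp del: Plus_def)
qed

end

theory Submission
  imports Defs
begin

text \<open>
  In \<open>G\<^sup>-\<^sup>+\<^sup>-\<close> a vertex \<open>v\<close> has degree \<open>m + n - 1 - 2 d(v)\<close> and an edge \<open>uw\<close> has degree
  \<open>d(u) + d(w) + n - 4\<close>. By double counting, the mean of the former over the vertices and the mean
  of the latter over the edges are the two bases on the right-hand side, so the bound is AM-GM
  applied to each of the two products. If both means are positive, equality forces all vertex
  degrees to coincide; if the vertex mean vanishes, so do all vertex terms; if the edge mean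
  vanishes, then \<open>G\<close> is a single edge on two vertices.
\<close>

section \<open>AM-GM for finite families of nonnegative reals, with strictness\<close>

lemma less_exp_minus_one:
  fixes x :: real
  assumes "x \<noteq> 1"
  shows "x < exp (x - 1)"
proof -
  have "x \<noteq> exp (x - 1)"
  proof
    assume eq: "x = exp (x - 1)"
    then have "x > 0" by (metis exp_gt_zero)
    moreover from eq have "ln x = x - 1" by (metis ln_exp)
    ultimately show False using ln_eq_minus_one assms by blast
  qed
  with exp_ge_add_one_self[of "x - 1"] show ?thesis by simp
qed

text \<open>Polya's argument: each factor satisfies \<open>t \<le> exp (t - 1)\<close>, and the
  exponents sum to zero because the mean is 1. The factor at \<open>j\<close> makes the bound
  strict.\<close>

lemma prod_less_one_if_mean_one:
  fixes y :: "'b \<Rightarrow> real"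
  assumes fin: "finite S" and nonneg: "\<And>i. i \<in> S \<Longrightarrow> y i \<ge> 0"
    and sum: "sum y S = card S" and j: "j \<in> S" "y j \<noteq> 1"
  shows "prod y S < 1"
proof -
  let ?e = "\<lambda>i. exp (y i - 1)"
  have le: "prod y (S - {j}) \<le> prod ?e (S - {j})"
    using nonneg exp_ge_add_one_self[of "y i - 1" for i] by (intro prod_mono) auto
  have pos: "prod ?e (S - {j}) > 0" by (intro prod_pos) simp
  have "prod y S = y j * prod y (S - {j})"
    using fin j by (simp add: prod.remove)
  also have "\<dots> \<le> y j * prod ?e (S - {j})"
    using le nonneg j by (intro mult_left_mono) auto
  \<comment> \<open>The other factors are already replaced by positive exponentials, so strictness
    at \<open>j\<close> survives even if some \<open>y i\<close> is zero.\<close>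
  also have "\<dots> < ?e j * prod ?e (S - {j})"
    using less_exp_minus_one[OF j(2)] pos by simp
  also have "\<dots> = prod ?e S"
    using fin j by (simp add: prod.remove)
  also have "\<dots> = exp (\<Sum>i\<in>S. y i - 1)"
    using fin by (simp add: exp_sum)
  also have "\<dots> = 1"
    using sum by (simp add: sum_subtractf)
  finally show ?thesis .
qed

text \<open>Dividing by \<open>a\<close> reduces to mean 1. This is legitimate since
  \<open>a = 0\<close> would make all the nonnegative terms vanish, leaving no \<open>j\<close> that
  differs from the mean.\<close>

lemma am_gm_strict:
  fixes x :: "'b \<Rightarrow> real" and a :: real
  assumes fin: "finite S" and nonneg: "\<And>i. i \<in> S \<Longrightarrow> x i \<ge> 0"
    and mean: "sum x S = card S * a" and j: "j \<in> S" "x j \<noteq> a"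
  shows "prod x S < a ^ card S"
proof -
  have "card S > 0" using fin j by (auto simp: card_gt_0_iff)
  have "a \<noteq> 0"
  proof
    assume "a = 0"
    then have "\<forall>i\<in>S. x i = 0"
      using mean nonneg sum_nonneg_eq_0_iff[OF fin, of x] by simp
    with \<open>a = 0\<close> j show False by simp
  qed
  moreover have "a \<ge> 0"
    using mean sum_nonneg[of S x] nonneg \<open>card S > 0\<close>
    by (metis of_nat_0_less_iff zero_le_mult_iff linorder_not_less)
  ultimately have a: "a > 0" by simp
  have "(\<Prod>i\<in>S. x i / a) < 1"
  proof (rule prod_less_one_if_mean_one[OF fin])
    show "(\<Sum>i\<in>S. x i / a) = card S"
      using mean a by (simp add: sum_divide_distrib[symmetric])
  qed (use nonneg a j in auto)
  then show ?thesis
    using a by (simp add: prod_dividef)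
qed

lemma am_gm_le:
  fixes x :: "'b \<Rightarrow> real" and a :: real
  assumes "finite S" "\<And>i. i \<in> S \<Longrightarrow> x i \<ge> 0" "sum x S = card S * a"
  shows "prod x S \<le> a ^ card S"
proof (cases "\<forall>i\<in>S. x i = a")
  case True
  then show ?thesis by simp
next
  case False
  then show ?thesis using am_gm_strict[OF assms] by force
qed

section \<open>Double counting of vertex-edge incidences\<close>

lemma finite_edges:
  assumes "fin_simple_graph G"
  shows "finite (edges G)"
proof -
  have "edges G \<subseteq> Pow (verts G)" "finite (verts G)"
    using assms by (auto simp: fin_simple_graph_def)
  then show ?thesis by (meson finite_Pow_iff finite_subset)
qed

text \<open>Both sides sum \<open>f v\<close> over incident pairs. The weight 1 gives the handshake
  identity, the weight \<open>degree G\<close> the edge form of the first Zagreb index.\<close>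

lemma sum_over_edges:
  assumes "fin_simple_graph G"
  shows "(\<Sum>e\<in>edges G. \<Sum>v\<in>e. f v) = (\<Sum>v\<in>verts G. degree G v * f v)"
proof -
  have fin: "finite (verts G)" "finite (edges G)"
    using assms finite_edges by (auto simp: fin_simple_graph_def)
  have "(\<Sum>e\<in>edges G. \<Sum>v\<in>e. f v) = (\<Sum>e\<in>edges G. \<Sum>v\<in>{v\<in>verts G. v \<in> e}. f v)"
    using assms by (intro sum.cong) (auto simp: fin_simple_graph_def)
  also have "\<dots> = (\<Sum>v\<in>verts G. \<Sum>e\<in>{e\<in>edges G. v \<in> e}. f v)"
    using fin by (simp add: sum.swap_restrict)
  finally show ?thesis by (simp add: degree_def)
qed

lemma handshake:
  assumes "fin_simple_graph G"
  shows "(\<Sum>v\<in>verts G. degree G v) = 2 * card (edges G)"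
proof -
  have "(\<Sum>v\<in>verts G. degree G v) = (\<Sum>e\<in>edges G. card e)"
    using sum_over_edges[OF assms, of "\<lambda>_. 1"] by simp
  also have "\<dots> = (\<Sum>e\<in>edges G. 2)"
    using assms by (intro sum.cong) (auto simp: fin_simple_graph_def)
  finally show ?thesis by simp
qed

lemma first_zagreb_edges:
  assumes "fin_simple_graph G"
  shows "first_zagreb G = (\<Sum>e\<in>edges G. \<Sum>v\<in>e. degree G v)"
  using sum_over_edges[OF assms, of "degree G"]
  by (simp add: first_zagreb_def power2_eq_square)

section \<open>Degrees in the transformation graph\<close>

lemma degree_eq_card_neighbours:
  assumes "fin_simple_graph H" "v \<in> verts H"
  shows "degree H v = card {w \<in> verts H. w \<noteq> v \<and> {v, w} \<in> edges H}"
proof -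
  \<comment> \<open>Edges at \<open>v\<close> correspond to their other endpoints; this passes from
    counting edges to counting neighbours, which is what \<open>trans_adj\<close> describes.\<close>
  have "{e \<in> edges H. v \<in> e} = (\<lambda>w. {v, w}) ` {w \<in> verts H. w \<noteq> v \<and> {v, w} \<in> edges H}"
  proof (intro equalityI subsetI)
    fix e assume e: "e \<in> {e \<in> edges H. v \<in> e}"
    then have "card e = 2" "e \<subseteq> verts H" using assms by (auto simp: fin_simple_graph_def)
    moreover from this(1) e obtain w where "e = {v, w}" "w \<noteq> v"
      by (auto simp: card_2_iff)
    ultimately show "e \<in> (\<lambda>w. {v, w}) ` {w \<in> verts H. w \<noteq> v \<and> {v, w} \<in> edges H}"
      using e by auto
  qed auto
  moreover have "inj_on (\<lambda>w. {v, w}) A" for A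
    by (auto simp: inj_on_def doubleton_eq_iff)
  ultimately show ?thesis by (simp add: degree_def card_image)
qed

lemma degree_total_trans:
  assumes "fin_simple_graph G" "p \<in> verts G <+> edges G"
  shows "degree (total_trans x y z G) p =
    card {w \<in> verts G. Inl w \<noteq> p \<and> trans_adj x y z G p (Inl w)}
    + card {e \<in> edges G. Inr e \<noteq> p \<and> trans_adj x y z G p (Inr e)}"
    (is "_ = card ?A + card ?B")
proof -
  let ?H = "total_trans x y z G"
  have verts: "verts ?H = verts G <+> edges G" by (simp add: total_trans_def)
  have "degree ?H p = card {q \<in> verts ?H. q \<noteq> p \<and> {p, q} \<in> edges ?H}"
    using assms by (intro degree_eq_card_neighbours fin_simple_graph_total_trans) (simp_all add: verts)
  also have "{q \<in> verts ?H. q \<noteq> p \<and> {p, q} \<in> edges ?H}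
      = {q \<in> verts G <+> edges G. q \<noteq> p \<and> trans_adj x y z G p q}"
    unfolding verts using total_trans_edge_iff[OF assms(2)] by metis
  also have "\<dots> = ?A <+> ?B" by auto
  also have "card \<dots> = card ?A + card ?B"
    using assms(1) finite_edges[OF assms(1)] by (intro card_Plus) (simp_all add: fin_simple_graph_def)
  finally show ?thesis .
qed

text \<open>The vertex is joined to its \<open>n - 1 - d\<close> non-neighbours and to the
  \<open>m - d\<close> edges that avoid it. The additive form avoids truncated subtraction.\<close>

lemma degree_trans_vertex:
  assumes G: "fin_simple_graph G" and v: "v \<in> verts G"
  shows "degree (total_trans Minus Plus Minus G) (Inl v) + 2 * degree G v + 1
    = card (verts G) + card (edges G)"
proof -
  have fin: "finite (verts G)" "finite (edges G)"
    using G finite_edges by (auto simp: fin_simple_graph_def)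
  let ?N = "{w \<in> verts G. w \<noteq> v \<and> {v, w} \<in> edges G}"
  let ?N' = "{w \<in> verts G. w \<noteq> v \<and> {v, w} \<notin> edges G}"
  let ?I = "{e \<in> edges G. v \<in> e}" and ?I' = "{e \<in> edges G. v \<notin> e}"
  have "verts G = insert v (?N \<union> ?N')" using v by auto
  then have "card (verts G) = card (insert v (?N \<union> ?N'))" by simp
  also have "\<dots> = 1 + (card ?N + card ?N')"
    using fin by (subst card_insert_disjoint) (auto intro!: card_Un_disjoint)
  finally have n: "card (verts G) = 1 + degree G v + card ?N'"
    using degree_eq_card_neighbours[OF G v] by simp
  have "edges G = ?I \<union> ?I'" by auto
  then have "card (edges G) = card (?I \<union> ?I')" by simp
  also have "\<dots> = card ?I + card ?I'"
    using fin by (intro card_Un_disjoint) auto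
  finally have m: "card (edges G) = degree G v + card ?I'"
    by (simp add: degree_def)
  have "degree (total_trans Minus Plus Minus G) (Inl v) = card ?N' + card ?I'"
    using v by (subst degree_total_trans[OF G]) auto
  with n m show ?thesis by simp
qed

text \<open>An edge \<open>uw\<close> is joined to the \<open>n - 2\<close> vertices off it and to
  the \<open>d(u) + d(w) - 2\<close> other edges that meet it.\<close>

lemma degree_trans_edge:
  assumes G: "fin_simple_graph G" and e: "e \<in> edges G"
  shows "degree (total_trans Minus Plus Minus G) (Inr e) + 4
    = card (verts G) + (\<Sum>v\<in>e. degree G v)"
proof -
  have fin: "finite (verts G)" "finite (edges G)"
    using G finite_edges by (auto simp: fin_simple_graph_def)
  have ce: "card e = 2" and sub: "e \<subseteq> verts G" and card2: "\<And>f. f \<in> edges G \<Longrightarrow> card f = 2"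
    using G e by (auto simp: fin_simple_graph_def)
  obtain u w where uw: "e = {u, w}" "u \<noteq> w" using ce by (auto simp: card_2_iff)
  let ?U = "{f \<in> edges G. u \<in> f}" and ?W = "{f \<in> edges G. w \<in> f}"
  let ?F = "{f \<in> edges G. f \<noteq> e \<and> e \<inter> f \<noteq> {}}"
  \<comment> \<open>In a simple graph two distinct vertices lie on at most one common edge. Hence
    \<open>e\<close> is counted twice in \<open>d(u) + d(w)\<close>, which accounts for the 2 in
    \<open>F\<close>.\<close>
  have common: "?U \<inter> ?W = {e}"
    using card2 e uw by (fastforce simp: card_2_iff)
  have "?U \<union> ?W = insert e ?F" using uw e by auto
  then have "card (?U \<union> ?W) = 1 + card ?F" using fin by simp
  with common have F: "degree G u + degree G w = card ?F + 2"
    using card_Un_Int[of ?U ?W] fin by (simp add: degree_def)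
  have "{v \<in> verts G. v \<notin> e} = verts G - e" by auto
  then have "card {v \<in> verts G. v \<notin> e} + 2 = card (verts G)"
    using card_Diff_subset[of e "verts G"] card_mono[OF fin(1) sub] sub ce fin
    by (simp add: finite_subset)
  moreover have "degree (total_trans Minus Plus Minus G) (Inr e)
      = card {v \<in> verts G. v \<notin> e} + card ?F"
    using e by (subst degree_total_trans[OF G]) auto
  ultimately show ?thesis using F uw by simp
qed

text \<open>The only possible edge is the whole vertex set, so every vertex lies on all edges. This
  settles the degenerate case where the edge mean is zero.\<close>

lemma regular_if_two_vertices:
  assumes "fin_simple_graph G" "card (verts G) = 2"
  shows "regular G"
proof -
  have edge: "e = verts G" if "e \<in> edges G" for e
    using assms that by (metis card_subset_eq fin_simple_graph_def)
  then have "degree G v = card (edges G)" if "v \<in> verts G" for v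
  proof -
    have "{e \<in> edges G. v \<in> e} = edges G" using edge that by auto
    then show ?thesis by (simp add: degree_def)
  qed
  then show ?thesis by (auto simp: regular_def)
qed

section \<open>Factorisation of the index, the bound and its equality case\<close>

lemma narumi_katayama_total_trans:
  assumes "fin_simple_graph G"
  shows "narumi_katayama (total_trans x y z G) =
    (\<Prod>v\<in>verts G. degree (total_trans x y z G) (Inl v))
    * (\<Prod>e\<in>edges G. degree (total_trans x y z G) (Inr e))"
proof -
  have "finite (verts G)" "finite (edges G)"
    using assms finite_edges by (auto simp: fin_simple_graph_def)
  moreover have "verts (total_trans x y z G) = verts G <+> edges G"
    by (simp add: total_trans_def)
  ultimately show ?thesis by (simp add: narumi_katayama_def prod.Plus del: Plus_def)
qed

theorem theorem13:
  fixes G :: "'a ugraph" and n m :: nat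
  assumes "fin_simple_graph G"
    and "n = card (verts G)"
    and "m = card (edges G)"
    and "m \<ge> 1"
  shows "real (narumi_katayama (total_trans Minus Plus Minus G))
           \<le> (real m + real n - 1 - 4 * real m / real n) ^ n
             * ((real n - 4) + 1 / real m * real (first_zagreb G)) ^ m
       \<and> (real (narumi_katayama (total_trans Minus Plus Minus G))
           = (real m + real n - 1 - 4 * real m / real n) ^ n
             * ((real n - 4) + 1 / real m * real (first_zagreb G)) ^ m
         \<longleftrightarrow> regular G)"
proof -
  note G = assms(1) and n = assms(2) and m = assms(3)
  define a where "a = real m + real n - 1 - 4 * real m / real n"
  define b where "b = (real n - 4) + 1 / real m * real (first_zagreb G)"
  define x where "x v = real (degree (total_trans Minus Plus Minus G) (Inl v))" for v
  define y where "y e = real (degree (total_trans Minus Plus Minus G) (Inr e))" for e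
  have fin: "finite (verts G)" "finite (edges G)"
    using G finite_edges by (auto simp: fin_simple_graph_def)
  \<comment> \<open>An edge forces \<open>n \<ge> 2\<close>, so the quotient by \<open>n\<close> in
    \<open>a\<close> is a genuine one; \<open>e0\<close> also serves the case \<open>b = 0\<close>
    below.\<close>
  obtain e0 where e0: "e0 \<in> edges G" using \<open>m \<ge> 1\<close> m by fastforce
  have "card e0 = 2" "e0 \<subseteq> verts G" using G e0 by (auto simp: fin_simple_graph_def)
  then have n2: "n \<ge> 2" using card_mono[OF fin(1)] n by metis
  have x: "x v = real m + real n - 1 - 2 * real (degree G v)" if "v \<in> verts G" for v
    using degree_trans_vertex[OF G that] n m unfolding x_def by linarith
  have y: "y e = real n - 4 + real (\<Sum>v\<in>e. degree G v)" if "e \<in> edges G" for e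
    using degree_trans_edge[OF G that] n unfolding y_def by linarith
  have "(\<Sum>v\<in>verts G. real (degree G v)) = 2 * m"
    using handshake[OF G] m by (metis of_nat_sum)
  \<comment> \<open>The sum is \<open>n * (m + n - 1) - 2 * (2 * m)\<close>, that is,
    \<open>n * a\<close>.\<close>
  then have sum_x: "sum x (verts G) = card (verts G) * a"
    using n2 by (simp add: x n[symmetric] sum_subtractf sum.distrib sum_distrib_left[symmetric]
        a_def algebra_simps)
  have "(\<Sum>e\<in>edges G. real (\<Sum>v\<in>e. degree G v)) = first_zagreb G"
    using first_zagreb_edges[OF G] by (metis of_nat_sum)
  then have sum_y: "sum y (edges G) = card (edges G) * b"
    using \<open>m \<ge> 1\<close> by (simp add: y m[symmetric] sum.distrib sum_subtractf b_def algebra_simps del: of_nat_sum)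
  have le_x: "prod x (verts G) \<le> a ^ n"
    using am_gm_le[OF fin(1) _ sum_x] n by (simp add: x_def)
  have le_y: "prod y (edges G) \<le> b ^ m"
    using am_gm_le[OF fin(2) _ sum_y] m by (simp add: y_def)
  have nonneg: "prod x (verts G) \<ge> 0" "prod y (edges G) \<ge> 0"
    by (simp_all add: x_def y_def prod_nonneg)
  have NK: "real (narumi_katayama (total_trans Minus Plus Minus G))
      = prod x (verts G) * prod y (edges G)"
    by (simp add: narumi_katayama_total_trans[OF G] x_def y_def)
  have "prod x (verts G) * prod y (edges G) = a ^ n * b ^ m" if "regular G"
  proof -
    from that obtain k where k: "\<And>v. v \<in> verts G \<Longrightarrow> degree G v = k"
      by (auto simp: regular_def)
    \<comment> \<open>A constant family equals its mean, so each product is exactly the power of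
      \<open>a\<close> or \<open>b\<close>.\<close>
    have xk: "x v = real m + real n - 1 - 2 * k" if "v \<in> verts G" for v
      using x[OF that] k[OF that] by simp
    then have "a = real m + real n - 1 - 2 * k" using sum_x n n2 by simp
    with xk have "prod x (verts G) = a ^ n" using n by simp
    have yk: "y e = real n - 4 + 2 * k" if "e \<in> edges G" for e
    proof -
      have "card e = 2" "e \<subseteq> verts G" using G that by (auto simp: fin_simple_graph_def)
      moreover from this have "(\<Sum>v\<in>e. degree G v) = (\<Sum>v\<in>e. k)"
        using k by (intro sum.cong) auto
      ultimately show ?thesis using y[OF that] by simp
    qed
    then have "b = real n - 4 + 2 * k" using sum_y m \<open>m \<ge> 1\<close> by simp
    with yk have "prod y (edges G) = b ^ m" using m by simp
    with \<open>prod x (verts G) = a ^ n\<close> show ?thesis by simp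
  qed
  moreover have "regular G" if eq: "prod x (verts G) * prod y (edges G) = a ^ n * b ^ m"
  \<comment> \<open>If \<open>b = 0\<close>, the right-hand side is zero whatever the vertex product
    is, so equality must be exploited differently: \<open>y e0 = 0\<close> gives
    \<open>n + d(u) + d(w) = 4\<close> for the endpoints of \<open>e0\<close>, whose degrees are at
    least 1, hence \<open>n = 2\<close>.\<close>
  proof (cases "b = 0")
    case True
    then have "\<forall>e\<in>edges G. y e = 0"
      using sum_y sum_nonneg_eq_0_iff[OF fin(2), of y] by (simp add: y_def)
    with y e0 have sum0: "real n + real (\<Sum>v\<in>e0. degree G v) = 4" by fastforce
    have "1 \<le> degree G v" if "v \<in> e0" for v
      using card_mono[of "{e \<in> edges G. v \<in> e}" "{e0}"] fin e0 that by (simp add: degree_def)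
    then have "(\<Sum>v\<in>e0. 1) \<le> (\<Sum>v\<in>e0. degree G v)" by (intro sum_mono)
    then have "2 \<le> (\<Sum>v\<in>e0. degree G v)" using \<open>card e0 = 2\<close> by simp
    with sum0 n2 have "n = 2" by linarith
    with G n show ?thesis by (intro regular_if_two_vertices) simp_all
  next
    case False
    have "card (edges G) * b \<ge> 0" using sum_y by (metis sum_nonneg y_def of_nat_0_le_iff)
    then have "b \<ge> 0" using m \<open>m \<ge> 1\<close> by (simp add: zero_le_mult_iff)
    with False have "b ^ m > 0" by simp
    \<comment> \<open>A strict loss in the vertex product cannot be recovered, since the edge
      product is at most \<open>b ^ m\<close> and \<open>b ^ m\<close> is positive. As
      \<open>x v\<close> is a strictly decreasing function of \<open>degree G v\<close>, constancy
      of \<open>x\<close> yields regularity.\<close>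
    have "x v = a" if v: "v \<in> verts G" for v
    proof (rule ccontr)
      assume "x v \<noteq> a"
      then have "prod x (verts G) < a ^ n"
        using am_gm_strict[OF fin(1) _ sum_x v] n by (simp add: x_def)
      then have "prod x (verts G) * b ^ m < a ^ n * b ^ m" using \<open>b ^ m > 0\<close> by simp
      moreover have "prod x (verts G) * prod y (edges G) \<le> prod x (verts G) * b ^ m"
        using le_y nonneg by (intro mult_left_mono)
      ultimately show False using eq by simp
    qed
    then have "degree G v = degree G w" if "v \<in> verts G" "w \<in> verts G" for v w
      using x[OF that(1)] x[OF that(2)] that by simp
    then show ?thesis unfolding regular_def by metis
  qed
  \<comment> \<open>Nonnegativity of \<open>a ^ n\<close> comes from its lying above the nonnegative
    vertex product.\<close>
  moreover have "prod x (verts G) * prod y (edges G) \<le> a ^ n * b ^ m"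
    using le_x le_y nonneg by (intro mult_mono) auto
  ultimately show ?thesis
    unfolding NK a_def[symmetric] b_def[symmetric] by blast
qed

end
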